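(* A scaling of a scalable $(w,N)$-solution produces a scalable $(w+2,3N)$-solution. That is, if a $(w,N)$-solution of the FC-problem is scalable, then its scaling to $3N$ coins can be extended by at most two further weighings to a $(w+2,3N)$-solution which is itself scalable.
   Context: FC-problem: there are $N\ge 2$ coins, identical in appearance. Exactly one is fake, exactly one (a different one) is a chameleon, and the remaining $N-2$ are real. All real coins have equal weight; the fake coin is lighter than a real coin. In each weighing the chameleon weighs either as much as a real coin or as much as the fake coin, the choice being made arbitrarily (adversarially) and independently for each weighing. A weighing places two disjoint sets of coins, with equal numbers of coins, on the two pans of a balance; the outcome is "balance", "first pan lighter" or "second pan lighter". Weighings are adaptive: each may depend on the outcomes of previous ones. The task is to output at most two coins such that the fake coin is guaranteed to be among them, whatever the positions of the fake and the chameleon and whatever the chameleon's behavior. A $(w,N)$-solution is an adaptive strategy that accomplishes this for $N$ coins using at most $w$ weighings. Scaling: given an adaptive strategy of weighings on $N$ coins, take $3N$ coins partitioned into $N$ triples, one for each of the original coins, and perform the same strategy with each coin replaced by its whole triple (triples are moved as single units). This strategy on $3N$ coins is the scaling of the original one. A $(w,N)$-solution is called scalable if the scaling of its $w$ weighings to $3N$ coins can be extended (by appending, after each sequence of outcomes, at most two further adaptive weighings of individual coins and an output) to a $(w+2,3N)$-solution of the FC-problem for $3N$ coins. *)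

theory Defs
  imports Complex_Main
begin

text \<open>
  The coins are numbered \<open>0, \<dots>, N - 1\<close>. An adaptive strategy is a decision tree. A node
  \<open>Weigh A B T\<^sub>0 T\<^sub>1 T\<^sub>2\<close> puts \<open>A\<close> on the first and \<open>B\<close> on the second pan and
  continues with \<open>T\<^sub>0\<close> on balance, with \<open>T\<^sub>1\<close> if the first pan is lighter and with \<open>T\<^sub>2\<close> if
  the second pan is lighter; a leaf announces a set of coins.
\<close>

datatype strategy =
    Output "nat set"
  | Weigh "nat set" "nat set" strategy strategy strategy

primrec num_weighings :: "strategy \<Rightarrow> nat" where
  "num_weighings (Output X) = 0"
| "num_weighings (Weigh A B T\<^sub>0 T\<^sub>1 T\<^sub>2) =
     Suc (max (num_weighings T\<^sub>0) (max (num_weighings T\<^sub>1) (num_weighings T\<^sub>2)))"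

primrec admissible :: "nat \<Rightarrow> strategy \<Rightarrow> bool" where
  "admissible N (Output X) \<longleftrightarrow> X \<subseteq> {..<N} \<and> card X \<le> 2"
| "admissible N (Weigh A B T\<^sub>0 T\<^sub>1 T\<^sub>2) \<longleftrightarrow>
     A \<subseteq> {..<N} \<and> B \<subseteq> {..<N} \<and> A \<inter> B = {} \<and> card A = card B \<and>
     admissible N T\<^sub>0 \<and> admissible N T\<^sub>1 \<and> admissible N T\<^sub>2"

text \<open>
  \<open>wt k i\<close> is the weight shown by coin \<open>i\<close> in the \<open>k\<close>-th weighing, counted from \<open>0\<close>;
  the remaining weighings are renumbered in the recursive calls.
\<close>

primrec run :: "(nat \<Rightarrow> nat \<Rightarrow> real) \<Rightarrow> strategy \<Rightarrow> nat set" where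
  "run wt (Output X) = X"
| "run wt (Weigh A B T\<^sub>0 T\<^sub>1 T\<^sub>2) =
     (let a = sum (wt 0) A; b = sum (wt 0) B; wt' = (\<lambda>k. wt (Suc k))
      in if a = b then run wt' T\<^sub>0 else if a < b then run wt' T\<^sub>1 else run wt' T\<^sub>2)"

text \<open>
  \<open>r\<close> and \<open>l\<close> are the weights of a real coin and of the fake coin \<open>f\<close>; the chameleon \<open>c\<close> weighs
  as much as the fake coin exactly in the weighings \<open>k\<close> with \<open>\<beta> k\<close>. Since a strategy is
  deterministic, it suffices to consider behaviours \<open>\<beta>\<close> that are fixed beforehand, even for a
  chameleon that reacts to the course of the weighings.
\<close>

definition coin_weight ::
    "real \<Rightarrow> real \<Rightarrow> nat \<Rightarrow> nat \<Rightarrow> (nat \<Rightarrow> bool) \<Rightarrow> nat \<Rightarrow> nat \<Rightarrow> real" where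
  "coin_weight r l f c \<beta> k i = (if i = f \<or> i = c \<and> \<beta> k then l else r)"

definition fc_solution :: "nat \<Rightarrow> nat \<Rightarrow> strategy \<Rightarrow> bool" where
  "fc_solution w N T \<longleftrightarrow>
     admissible N T \<and> num_weighings T \<le> w \<and>
     (\<forall>r l f c \<beta>. 0 < l \<longrightarrow> l < r \<longrightarrow> f < N \<longrightarrow> c < N \<longrightarrow> f \<noteq> c \<longrightarrow>
        f \<in> run (coin_weight r l f c \<beta>) T)"

text \<open>Coin \<open>i\<close> is replaced by the triple of coins \<open>3i, 3i + 1, 3i + 2\<close>.\<close>

definition triples :: "nat set \<Rightarrow> nat set" where
  "triples A = (\<Union>i\<in>A. {3 * i, 3 * i + 1, 3 * i + 2})"

text \<open>
  Only the weighings of a scaling matter: its leaves, which may announce up to six coins,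
  are replaced in \<open>extends_by\<close> below.
\<close>

primrec scaling :: "strategy \<Rightarrow> strategy" where
  "scaling (Output X) = Output (triples X)"
| "scaling (Weigh A B T\<^sub>0 T\<^sub>1 T\<^sub>2) =
     Weigh (triples A) (triples B) (scaling T\<^sub>0) (scaling T\<^sub>1) (scaling T\<^sub>2)"

text \<open>
  \<open>extends_by n S T\<close>: \<open>T\<close> arises from \<open>S\<close> by putting a strategy with at most \<open>n\<close> weighings
  in place of each leaf.
\<close>

inductive extends_by :: "nat \<Rightarrow> strategy \<Rightarrow> strategy \<Rightarrow> bool" for n :: nat where
  leaf: "num_weighings T \<le> n \<Longrightarrow> extends_by n (Output X) T"
| node: "extends_by n S\<^sub>0 T\<^sub>0 \<Longrightarrow> extends_by n S\<^sub>1 T\<^sub>1 \<Longrightarrow> extends_by n S\<^sub>2 T\<^sub>2 \<Longrightarrow>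
    extends_by n (Weigh A B S\<^sub>0 S\<^sub>1 S\<^sub>2) (Weigh A B T\<^sub>0 T\<^sub>1 T\<^sub>2)"

definition scalable_solution :: "nat \<Rightarrow> nat \<Rightarrow> strategy \<Rightarrow> bool" where
  "scalable_solution w N S \<longleftrightarrow>
     fc_solution w N S \<and>
     (\<exists>T. extends_by 2 (scaling S) T \<and> fc_solution (w + 2) (3 * N) T)"

end

theory Submission
  imports Defs
begin

text \<open>
  The knowledge after some weighings is the relation \<open>Q\<close> of all pairs (fake, chameleon) that are
  still possible. A diagonal pair \<open>(t, t)\<close> records that \<open>t\<close> explains the outcomes without help
  of the chameleon; then every chameleon is possible, and after tripling the chameleon may even
  belong to the triple of \<open>t\<close>. With this convention weighing commutes with tripling.

  At a leaf of a solution at most two coins \<open>a, b\<close> can be the fake. The tripled situation can be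
  settled by two weighings if and only if, up to exchanging \<open>a\<close> and \<open>b\<close>, the pair \<open>(b, b)\<close> and one of
  \<open>(a, a)\<close>, \<open>(b, a)\<close> are impossible (\<open>good\<close> below). Necessity is a counting argument. For
  sufficiency the two weighings can be chosen such that every situation after them is good again,
  so that scaling can be repeated.
\<close>

section \<open>Knowledge as a set of possible pairs\<close>

definition balanced :: "nat set \<Rightarrow> nat set \<Rightarrow> (nat \<times> nat) set \<Rightarrow> (nat \<times> nat) set" where
  "balanced A B Q = {(f, c) \<in> Q. f \<notin> A \<and> f \<notin> B \<or> f \<in> A \<and> c \<in> B \<or> f \<in> B \<and> c \<in> A}"

text \<open>For distinct \<open>f\<close> and \<open>c\<close> and disjoint pans, both filters keep
  the pair as soon as one of the two weights of the chameleon produces the outcome; a pair may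
  survive several outcomes.\<close>

definition lighter :: "nat set \<Rightarrow> nat set \<Rightarrow> (nat \<times> nat) set \<Rightarrow> (nat \<times> nat) set" where
  "lighter A B Q = {(f, c) \<in> Q. f \<in> A \<or> f \<notin> B \<and> c \<in> A}"

primrec solves :: "strategy \<Rightarrow> (nat \<times> nat) set \<Rightarrow> bool" where
  "solves (Output X) Q \<longleftrightarrow> fst ` Q \<subseteq> X"
| "solves (Weigh A B T\<^sub>0 T\<^sub>1 T\<^sub>2) Q \<longleftrightarrow>
     solves T\<^sub>0 (balanced A B Q) \<and> solves T\<^sub>1 (lighter A B Q) \<and> solves T\<^sub>2 (lighter B A Q)"

text \<open>Announced sets are ignored because extending a scaling replaces them.\<close>

primrec all_leaves :: "((nat \<times> nat) set \<Rightarrow> bool) \<Rightarrow> strategy \<Rightarrow> (nat \<times> nat) set \<Rightarrow> bool" where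
  "all_leaves P (Output X) Q \<longleftrightarrow> P Q"
| "all_leaves P (Weigh A B T\<^sub>0 T\<^sub>1 T\<^sub>2) Q \<longleftrightarrow>
     all_leaves P T\<^sub>0 (balanced A B Q) \<and> all_leaves P T\<^sub>1 (lighter A B Q) \<and>
     all_leaves P T\<^sub>2 (lighter B A Q)"

text \<open>Triples move as units, so a chameleon in the triple of the fake never changes an
  outcome; such pairs are governed by the diagonal pair of that triple.\<close>

definition triple_pairs :: "(nat \<times> nat) set \<Rightarrow> (nat \<times> nat) set" where
  "triple_pairs Q = {(f, c). (f div 3, c div 3) \<in> Q}"

lemma balanced_mono: "Q \<subseteq> R \<Longrightarrow> balanced A B Q \<subseteq> balanced A B R"
  by (auto simp: balanced_def)

lemma lighter_mono: "Q \<subseteq> R \<Longrightarrow> lighter A B Q \<subseteq> lighter A B R"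
  by (auto simp: lighter_def)

lemma solves_mono: "solves T R \<Longrightarrow> Q \<subseteq> R \<Longrightarrow> solves T Q"
proof (induction T arbitrary: Q R)
  case (Output X)
  then show ?case by (auto simp: subset_iff)
next
  case (Weigh A B T\<^sub>0 T\<^sub>1 T\<^sub>2)
  then show ?case
    by (metis balanced_mono lighter_mono solves.simps(2))
qed

lemma solves_empty: "solves T {}"
  by (induction T) (auto simp: balanced_def lighter_def)

text \<open>Filtering distributes over unions, so a tree may be checked one pair at a time.\<close>

lemma solves_Un: "solves T (Q \<union> R) \<longleftrightarrow> solves T Q \<and> solves T R"
proof (induction T arbitrary: Q R)
  case (Output X)
  then show ?case by auto
next
  case (Weigh A B T\<^sub>0 T\<^sub>1 T\<^sub>2)
  have "balanced A B (Q \<union> R) = balanced A B Q \<union> balanced A B R"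
    "lighter A B (Q \<union> R) = lighter A B Q \<union> lighter A B R"
    "lighter B A (Q \<union> R) = lighter B A Q \<union> lighter B A R"
    by (auto simp: balanced_def lighter_def)
  with Weigh show ?case by auto
qed

lemma solves_finite_iff: "finite Q \<Longrightarrow> solves T Q \<longleftrightarrow> (\<forall>p\<in>Q. solves T {p})"
proof (induction Q rule: finite_induct)
  case empty
  then show ?case by (simp add: solves_empty)
next
  case (insert p Q)
  then show ?case using solves_Un[of T "{p}" Q] by simp
qed

section \<open>From balance outcomes to knowledge\<close>

lemma sum_coin_weight:
  assumes "finite A" "f \<noteq> c"
  shows "sum (coin_weight r l f c \<beta> k) A =
    r * card A - (r - l) * (of_bool (f \<in> A) + of_bool (c \<in> A \<and> \<beta> k))"
  using assms(1)
proof (induction A rule: finite_induct)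
  case empty
  then show ?case by simp
next
  case (insert x A)
  then show ?case using assms(2) by (auto simp: coin_weight_def algebra_simps)
qed

lemma weighing_outcome:
  fixes r l :: real and \<beta> :: "nat \<Rightarrow> bool" and k :: nat
  assumes "finite A" "finite B" "card A = card B" "f \<noteq> c" "l < r"
  defines "light X \<equiv> (of_bool (f \<in> X) + of_bool (c \<in> X \<and> \<beta> k) :: real)"
  shows "sum (coin_weight r l f c \<beta> k) A = sum (coin_weight r l f c \<beta> k) B \<longleftrightarrow> light A = light B"
    and "sum (coin_weight r l f c \<beta> k) A < sum (coin_weight r l f c \<beta> k) B \<longleftrightarrow> light B < light A"
  using assms by (simp_all add: sum_coin_weight)

text \<open>The weight of the chameleon is chosen anew in each weighing, so ranging over all \<beta>
  visits exactly the branches whose filters keep the pair.\<close>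

lemma solves_single_iff_run:
  assumes "f \<noteq> c" "l < r" "admissible N T"
  shows "solves T {(f, c)} \<longleftrightarrow> (\<forall>\<beta>. f \<in> run (coin_weight r l f c \<beta>) T)"
  using assms(3)
proof (induction T)
  case (Output X)
  then show ?case by simp
next
  case (Weigh A B T\<^sub>0 T\<^sub>1 T\<^sub>2)
  then have fin: "finite A" "finite B" and AB: "A \<inter> B = {}" "card A = card B"
    unfolding admissible.simps by (meson finite_subset finite_lessThan)+
  have shift: "(\<lambda>k. coin_weight r l f c \<beta> (Suc k)) = coin_weight r l f c (\<lambda>k. \<beta> (Suc k))" for \<beta>
    by (auto simp: coin_weight_def fun_eq_iff)
  have all: "(\<forall>\<beta>. P (\<beta> 0) (\<lambda>k. \<beta> (Suc k))) \<longleftrightarrow> (\<forall>b \<gamma>. P b \<gamma>)" for P :: "bool \<Rightarrow> (nat \<Rightarrow> bool) \<Rightarrow> bool"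
  proof
    assume *: "\<forall>\<beta>. P (\<beta> 0) (\<lambda>k. \<beta> (Suc k))"
    show "\<forall>b \<gamma>. P b \<gamma>"
    proof (intro allI)
      fix b \<gamma> show "P b \<gamma>" using *[rule_format, of "case_nat b \<gamma>"] by simp
    qed
  qed auto
  define light where "light b X = (of_bool (f \<in> X) + of_bool (c \<in> X \<and> b) :: real)" for b X
  define G where "G T \<longleftrightarrow> (\<forall>\<gamma>. f \<in> run (coin_weight r l f c \<gamma>) T)" for T
  have "(\<forall>\<beta>. f \<in> run (coin_weight r l f c \<beta>) (Weigh A B T\<^sub>0 T\<^sub>1 T\<^sub>2)) \<longleftrightarrow>
    (\<forall>b \<gamma>. f \<in> (if light b A = light b B then run (coin_weight r l f c \<gamma>) T\<^sub>0
      else if light b B < light b A then run (coin_weight r l f c \<gamma>) T\<^sub>1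
      else run (coin_weight r l f c \<gamma>) T\<^sub>2))"
    unfolding run.simps Let_def shift weighing_outcome[OF fin AB(2) assms(1,2)] light_def
    by (rule all)
  also have "\<dots> \<longleftrightarrow> (\<forall>b. if light b A = light b B then G T\<^sub>0
      else if light b B < light b A then G T\<^sub>1 else G T\<^sub>2)"
    by (auto simp: G_def)
  also have "\<dots> \<longleftrightarrow> solves (Weigh A B T\<^sub>0 T\<^sub>1 T\<^sub>2) {(f, c)}"
  proof -
    have G: "solves T\<^sub>0 {(f, c)} = G T\<^sub>0" "solves T\<^sub>1 {(f, c)} = G T\<^sub>1" "solves T\<^sub>2 {(f, c)} = G T\<^sub>2"
      using Weigh by (auto simp: G_def)
    \<comment> \<open>A branch that the pair cannot enter receives the empty set, on which
      \<open>solves\<close> is trivial.\<close>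
    have bal: "balanced A B {(f, c)} =
        (if f \<notin> A \<and> f \<notin> B \<or> f \<in> A \<and> c \<in> B \<or> f \<in> B \<and> c \<in> A then {(f, c)} else {})"
      and lig: "lighter X Y {(f, c)} = (if f \<in> X \<or> f \<notin> Y \<and> c \<in> X then {(f, c)} else {})" for X Y
      by (auto simp: balanced_def lighter_def)
    have "f \<notin> A \<or> f \<notin> B" "c \<notin> A \<or> c \<notin> B" using AB(1) by auto
    then show ?thesis
      unfolding solves.simps bal lig all_bool_eq light_def
      by (cases "f \<in> A"; cases "f \<in> B"; cases "c \<in> A"; cases "c \<in> B")
        (auto simp: G solves_empty)
  qed
  finally show ?case by simp
qed

section \<open>Diagonal pairs\<close>

lemma balanced_Diff: "balanced A B (Q - R) = balanced A B Q - R"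
  by (auto simp: balanced_def)

lemma lighter_Diff: "lighter A B (Q - R) = lighter A B Q - R"
  by (auto simp: lighter_def)

definition full_rows :: "nat \<Rightarrow> (nat \<times> nat) set \<Rightarrow> bool" where
  "full_rows N Q \<longleftrightarrow> Q \<subseteq> {..<N} \<times> {..<N} \<and> (\<forall>t c. (t, t) \<in> Q \<longrightarrow> c < N \<longrightarrow> (t, c) \<in> Q)"

text \<open>A diagonal pair survives only the outcome that its coin causes alone, and every
  chameleon permits this outcome by showing the real weight.\<close>

lemma full_rows_balanced: "full_rows N Q \<Longrightarrow> A \<inter> B = {} \<Longrightarrow> full_rows N (balanced A B Q)"
  by (auto simp: full_rows_def balanced_def)

lemma full_rows_lighter: "full_rows N Q \<Longrightarrow> A \<inter> B = {} \<Longrightarrow> full_rows N (lighter A B Q)"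
  by (auto simp: full_rows_def lighter_def)

text \<open>A diagonal pair adds no candidate: its row is full and contains a chameleon other than
  the coin itself.\<close>

lemma solves_Diff_Id:
  assumes "N \<ge> 2" "full_rows N Q" "admissible N T"
  shows "solves T (Q - Id) \<longleftrightarrow> solves T Q"
  using assms(2,3)
proof (induction T arbitrary: Q)
  case (Output X)
  have "\<exists>c. (f, c) \<in> Q - Id" if "(f, f) \<in> Q" for f
  proof -
    \<comment> \<open>Any coin other than \<open>f\<close> serves; \<open>N \<ge> 2\<close> makes
      both \<open>0\<close> and \<open>1\<close> available.\<close>
    have "(if f = 0 then 1 else 0) < N" using assms(1) by simp
    with that Output(1) have "(f, if f = 0 then 1 else 0) \<in> Q"
      by (simp add: full_rows_def)
    then show ?thesis by (intro exI[of _ "if f = 0 then 1 else 0"]) (auto split: if_splits)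
  qed
  then have "fst ` (Q - Id) = fst ` Q"
    by (force simp: image_iff)
  then show ?case by simp
next
  case (Weigh A B T\<^sub>0 T\<^sub>1 T\<^sub>2)
  then show ?case
    by (simp add: balanced_Diff lighter_Diff full_rows_balanced full_rows_lighter Int_commute)
qed

definition all_pairs :: "nat \<Rightarrow> (nat \<times> nat) set" where
  "all_pairs N = {..<N} \<times> {..<N}"

text \<open>Diagonal pairs are no configurations of the problem, but including them is harmless and
  gives a starting knowledge that is compatible with tripling.\<close>

lemma fc_solution_iff_solves:
  assumes "N \<ge> 2"
  shows "fc_solution w N T \<longleftrightarrow> admissible N T \<and> num_weighings T \<le> w \<and> solves T (all_pairs N)"
proof (cases "admissible N T")
  case True
  have "solves T (all_pairs N) \<longleftrightarrow> solves T (all_pairs N - Id)"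
    using assms True by (intro solves_Diff_Id[symmetric]) (auto simp: full_rows_def all_pairs_def)
  also have "\<dots> \<longleftrightarrow> (\<forall>p\<in>all_pairs N - Id. solves T {p})"
    by (rule solves_finite_iff) (simp add: all_pairs_def)
  also have "\<dots> \<longleftrightarrow> (\<forall>f c. f < N \<longrightarrow> c < N \<longrightarrow> f \<noteq> c \<longrightarrow> solves T {(f, c)})"
    by (auto simp: all_pairs_def)
  also have "\<dots> \<longleftrightarrow> (\<forall>r l f c \<beta>. 0 < l \<longrightarrow> l < r \<longrightarrow> f < N \<longrightarrow> c < N \<longrightarrow> f \<noteq> c \<longrightarrow>
      f \<in> run (coin_weight r l f c \<beta>) T)" (is "?L \<longleftrightarrow> ?R")
  proof
    assume ?L
    then show ?R using solves_single_iff_run[OF _ _ True] by blast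
  next
    assume R: ?R
    show ?L
    proof (intro allI impI)
      fix f c assume "f < N" "c < N" "f \<noteq> c"
      \<comment> \<open>Outcomes depend only on \<open>l < r\<close>, so \<open>l = 1\<close> and
        \<open>r = 2\<close> are as good as any weights.\<close>
      then show "solves T {(f, c)}"
        using R[rule_format, of 1 2 f c] solves_single_iff_run[OF _ _ True, of f c 1 2] by simp
    qed
  qed
  finally show ?thesis by (auto simp: fc_solution_def)
next
  case False
  then show ?thesis by (simp add: fc_solution_def)
qed

section \<open>Tripling a strategy\<close>

lemma mem_triple: "x \<in> {3 * i, 3 * i + 1, 3 * i + 2} \<longleftrightarrow> x div 3 = i" for x i :: nat
  unfolding insert_iff empty_iff by arith

lemma mem_triples: "x \<in> triples A \<longleftrightarrow> x div 3 \<in> A"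
  unfolding triples_def UN_iff mem_triple by auto

lemma card_triples:
  assumes "finite A"
  shows "card (triples A) = 3 * card A"
proof -
  have "{3 * i, 3 * i + 1, 3 * i + 2} \<inter> {3 * j, 3 * j + 1, 3 * j + 2} = {}"
    if "i \<noteq> j" for i j :: nat
    using that by (metis disjoint_iff mem_triple)
  then have "card (triples A) = (\<Sum>i\<in>A. card {3 * i, 3 * i + 1, 3 * i + 2})"
    unfolding triples_def using assms by (intro card_UN_disjoint) auto
  then show ?thesis by simp
qed

lemma balanced_triples:
  "balanced (triples A) (triples B) (triple_pairs Q) = triple_pairs (balanced A B Q)"
  by (auto simp: balanced_def triple_pairs_def mem_triples)

lemma lighter_triples:
  "lighter (triples A) (triples B) (triple_pairs Q) = triple_pairs (lighter A B Q)"
  by (auto simp: lighter_def triple_pairs_def mem_triples)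

lemma triple_pairs_all_pairs: "triple_pairs (all_pairs N) = all_pairs (3 * N)"
  by (auto simp: triple_pairs_def all_pairs_def)

lemma triples_subset: "A \<subseteq> {..<N} \<Longrightarrow> triples A \<subseteq> {..<3 * N}"
  by (auto simp: triples_def)

lemma triples_disjoint: "A \<inter> B = {} \<Longrightarrow> triples A \<inter> triples B = {}"
  by (auto simp: mem_triples)

inductive_cases extends_by_OutputE: "extends_by n (Output X) T"
inductive_cases extends_by_WeighE: "extends_by n (Weigh A B S\<^sub>0 S\<^sub>1 S\<^sub>2) T"

text \<open>Filtering commutes with tripling, so the subtree that replaces a leaf of
  \<open>S\<close> has to resolve the tripled knowledge of that leaf. The set announced by
  \<open>S\<close> bounds the candidates.\<close>

lemma all_leaves_of_extension:
  assumes "extends_by n (scaling S) T" "solves T (triple_pairs Q)" "admissible (3 * N) T"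
    "full_rows N Q" "admissible N S" "solves S Q"
  shows "all_leaves (\<lambda>Q. full_rows N Q \<and> (\<exists>X\<subseteq>{..<N}. card X \<le> 2 \<and> fst ` Q \<subseteq> X) \<and>
      (\<exists>t. num_weighings t \<le> n \<and> admissible (3 * N) t \<and> solves t (triple_pairs Q))) S Q"
  using assms
proof (induction S arbitrary: T Q)
  case (Output X)
  then show ?case by (auto elim: extends_by_OutputE)
next
  case (Weigh A B S\<^sub>0 S\<^sub>1 S\<^sub>2)
  from Weigh.prems(1) obtain T\<^sub>0 T\<^sub>1 T\<^sub>2 where "T = Weigh (triples A) (triples B) T\<^sub>0 T\<^sub>1 T\<^sub>2"
    "extends_by n (scaling S\<^sub>0) T\<^sub>0" "extends_by n (scaling S\<^sub>1) T\<^sub>1" "extends_by n (scaling S\<^sub>2) T\<^sub>2"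
    by (auto elim: extends_by_WeighE)
  with Weigh show ?case
    by (simp add: full_rows_balanced full_rows_lighter Int_commute balanced_triples lighter_triples)
qed

text \<open>Conversely, subtrees for the leaves are glued below the scaling. \<open>P'\<close>
  records the new leaves, so that the construction can be iterated.\<close>

lemma extension_of_all_leaves:
  assumes leaf: "\<And>Q. P Q \<Longrightarrow> \<exists>t. num_weighings t \<le> n \<and> admissible (3 * N) t \<and>
      solves t (triple_pairs Q) \<and> all_leaves P' t (triple_pairs Q)"
    and "admissible N S" "all_leaves P S Q"
  shows "\<exists>T. extends_by n (scaling S) T \<and> admissible (3 * N) T \<and>
      num_weighings T \<le> num_weighings S + n \<and> solves T (triple_pairs Q) \<and>
      all_leaves P' T (triple_pairs Q)"
  using assms(2,3)
proof (induction S arbitrary: Q)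
  case (Output X)
  then show ?case using leaf[of Q] by (auto intro: extends_by.leaf)
next
  case (Weigh A B S\<^sub>0 S\<^sub>1 S\<^sub>2)
  define E where "E S T Q \<longleftrightarrow> extends_by n (scaling S) T \<and> admissible (3 * N) T \<and>
      num_weighings T \<le> num_weighings S + n \<and> solves T (triple_pairs Q) \<and>
      all_leaves P' T (triple_pairs Q)" for S T Q
  obtain T\<^sub>0 T\<^sub>1 T\<^sub>2 where "E S\<^sub>0 T\<^sub>0 (balanced A B Q)" "E S\<^sub>1 T\<^sub>1 (lighter A B Q)" "E S\<^sub>2 T\<^sub>2 (lighter B A Q)"
    using Weigh unfolding E_def by (metis admissible.simps(2) all_leaves.simps(2))
  moreover have "finite A" "finite B" using Weigh.prems by (auto intro: finite_subset)
  ultimately have "E (Weigh A B S\<^sub>0 S\<^sub>1 S\<^sub>2) (Weigh (triples A) (triples B) T\<^sub>0 T\<^sub>1 T\<^sub>2) Q"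
    using Weigh.prems(1)
    by (auto simp: E_def balanced_triples lighter_triples card_triples triples_disjoint
        intro!: extends_by.node dest: triples_subset)
  then show ?case unfolding E_def by blast
qed

section \<open>Good leaves and two weighings that resolve them\<close>

definition good :: "nat \<Rightarrow> (nat \<times> nat) set \<Rightarrow> bool" where
  "good N Q \<longleftrightarrow> (\<exists>a<N. \<exists>b<N. a \<noteq> b \<and> fst ` Q \<subseteq> {a, b} \<and> (b, b) \<notin> Q \<and> ((a, a) \<notin> Q \<or> (b, a) \<notin> Q))"

lemma goodI:
  assumes "a < N" "b < N" "a \<noteq> b" "\<And>f c. (f, c) \<in> Q \<Longrightarrow> f = a \<or> f = b \<and> c \<noteq> b"
    "(a, a) \<notin> Q \<or> (b, a) \<notin> Q"
  shows "good N Q"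
  unfolding good_def using assms by (intro exI[of _ a] exI[of _ b]) fastforce

lemma good_mono: "good N R \<Longrightarrow> Q \<subseteq> R \<Longrightarrow> good N Q"
  unfolding good_def by blast

lemma all_leaves_antimono:
  assumes "\<And>Q R. P R \<Longrightarrow> Q \<subseteq> R \<Longrightarrow> P Q"
  shows "all_leaves P T R \<Longrightarrow> Q \<subseteq> R \<Longrightarrow> all_leaves P T Q"
proof (induction T arbitrary: Q R)
  case (Output X)
  then show ?case using assms by auto
next
  case (Weigh A B T\<^sub>0 T\<^sub>1 T\<^sub>2)
  then show ?case
    by (metis balanced_mono lighter_mono all_leaves.simps(2))
qed

lemma two_candidates:
  fixes n :: nat
  assumes "n \<ge> 2" "X \<subseteq> {..<n}" "card X \<le> 2"
  obtains a b where "a < n" "b < n" "a \<noteq> b" "X \<subseteq> {a, b}"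
proof -
  obtain Y where Y: "X \<subseteq> Y" "Y \<subseteq> {..<n}" "card Y = 2"
    using exists_subset_between[of X 2 "{..<n}"] assms by auto
  then obtain a b where "Y = {a, b}" "a \<noteq> b" by (metis card_2_iff)
  with Y that[of a b] show ?thesis by auto
qed

text \<open>Filtering creates no diagonal pairs, and without them \<open>good\<close> asks only for
  at most two candidates, which the announced set guarantees.\<close>

lemma irreflexive_all_leaves_good:
  assumes "n \<ge> 2" "admissible n T" "solves T Q" "\<And>x. (x, x) \<notin> Q"
  shows "all_leaves (good n) T Q"
  using assms(2-)
proof (induction T arbitrary: Q)
  case (Output X)
  obtain a b where "a < n" "b < n" "a \<noteq> b" "X \<subseteq> {a, b}"
    by (rule two_candidates[OF assms(1), of X]) (use Output in auto)
  with Output show ?case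
    unfolding good_def all_leaves.simps by (intro exI[of _ a] conjI exI[of _ b]) auto
next
  case (Weigh A B T\<^sub>0 T\<^sub>1 T\<^sub>2)
  then show ?case by (simp add: balanced_def lighter_def)
qed

text \<open>A chameleon outside the triple of the fake is off the pans while two coins of this
  triple are compared, so the comparison identifies the fake within it. One comparison per triple
  leaves one candidate in each.\<close>

lemma strategy_two_irreflexive:
  assumes dist: "distinct [a1, a2, a3, b1, b2, b3]" and lt: "{a1, a2, a3, b1, b2, b3} \<subseteq> {..<n}"
  defines "R \<equiv> {(f, c). f \<in> {a1, a2, a3} \<and> c \<notin> {a1, a2, a3} \<or> f \<in> {b1, b2, b3} \<and> c \<notin> {b1, b2, b3}}"
  shows "\<exists>t. num_weighings t \<le> 2 \<and> admissible n t \<and> solves t R \<and> all_leaves (good n) t R"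
proof -
  let ?t = "\<lambda>x. Weigh {b1} {b2} (Output {x, b3}) (Output {x, b1}) (Output {x, b2})"
  let ?T = "Weigh {a1} {a2} (?t a3) (?t a1) (?t a2)"
  have "num_weighings ?T \<le> 2" by simp
  moreover have "admissible n ?T" using lt dist by (auto simp: card_insert_if)
  moreover have "solves ?T R"
    using dist by (auto simp: balanced_def lighter_def R_def)
  moreover have "all_leaves (good n) ?T R"
  proof (rule irreflexive_all_leaves_good)
    have "a1 \<noteq> a2" "a1 < n" "a2 < n" using dist lt by auto
    then show "n \<ge> 2" by linarith
    show "(x, x) \<notin> R" for x using dist by (auto simp: R_def)
  qed fact+
  ultimately show ?thesis by blast
qed

text \<open>All six coins go on the pans first. A fake among the \<open>b\<close> coins then always
  tips the balance, since its chameleon is not on the pans; hence balance points to an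
  \<open>a\<close> coin with the chameleon opposite. Each tilt leaves three candidates.\<close>

lemma strategy_one_reflexive:
  assumes dist: "distinct [a1, a2, a3, b1, b2, b3]" and lt: "{a1, a2, a3, b1, b2, b3} \<subseteq> {..<n}"
  defines "R \<equiv> {(f, c). f \<in> {a1, a2, a3} \<or> f \<in> {b1, b2, b3} \<and> c \<notin> {a1, a2, a3, b1, b2, b3}}"
  shows "\<exists>t. num_weighings t \<le> 2 \<and> admissible n t \<and> solves t R \<and> all_leaves (good n) t R"
proof -
  let ?T = "Weigh {a1, a2, b1} {a3, b2, b3}
    (Weigh {a1} {a2} (Output {a3}) (Output {a1, a3}) (Output {a2, a3}))
    (Weigh {a1, b1} {a2, a3} (Output {a1, a2}) (Output {a1, b1}) (Output {a2}))
    (Weigh {b2} {b3} (Output {a3}) (Output {b2, a3}) (Output {b3, a3}))"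
  let ?E = "balanced {a1, a2, b1} {a3, b2, b3} R"
  let ?L = "lighter {a1, a2, b1} {a3, b2, b3} R"
  let ?G = "lighter {a3, b2, b3} {a1, a2, b1} R"
  have E: "?E = {a1, a2} \<times> {a3, b2, b3} \<union> {a3} \<times> {a1, a2, b1}"
    using dist by (auto simp: balanced_def R_def)
  have L: "?L = {(f, c). f \<in> {a1, a2} \<or> f = b1 \<and> c \<notin> {a1, a2, a3, b1, b2, b3}}"
    using dist by (auto simp: lighter_def R_def)
  have G: "?G = {(f, c). f = a3 \<or> f \<in> {b2, b3} \<and> c \<notin> {a1, a2, a3, b1, b2, b3}}"
    using dist by (auto simp: lighter_def R_def)
  have "num_weighings ?T \<le> 2" by simp
  moreover have "admissible n ?T" using lt dist by (auto simp: card_insert_if)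
  moreover have "solves ?T R"
    unfolding solves.simps E L G using dist by (auto simp: balanced_def lighter_def)
  moreover have "all_leaves (good n) ?T R"
    unfolding all_leaves.simps E L G
  proof (intro conjI)
    \<comment> \<open>Only \<open>a3\<close> is a candidate; \<open>b1\<close> is padding, as
      \<open>good\<close> names two distinct coins.\<close>
    show "good n (balanced {a1} {a2} ({a1, a2} \<times> {a3, b2, b3} \<union> {a3} \<times> {a1, a2, b1}))"
      by (rule goodI[of a3 _ b1]) (use lt dist in \<open>auto simp: balanced_def\<close>)
    show "good n (lighter {a1} {a2} ({a1, a2} \<times> {a3, b2, b3} \<union> {a3} \<times> {a1, a2, b1}))"
      by (rule goodI[of a1 _ a3]) (use lt dist in \<open>auto simp: lighter_def\<close>)
    show "good n (lighter {a2} {a1} ({a1, a2} \<times> {a3, b2, b3} \<union> {a3} \<times> {a1, a2, b1}))"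
      by (rule goodI[of a2 _ a3]) (use lt dist in \<open>auto simp: lighter_def\<close>)
  next
    let ?L = "{(f, c). f \<in> {a1, a2} \<or> f = b1 \<and> c \<notin> {a1, a2, a3, b1, b2, b3}}"
    \<comment> \<open>Balance puts the chameleon opposite the fake, so no diagonal pair
      remains.\<close>
    show "good n (balanced {a1, b1} {a2, a3} ?L)"
      by (rule goodI[of a1 _ a2]) (use lt dist in \<open>auto simp: balanced_def\<close>)
    \<comment> \<open>Here \<open>(a1, a1)\<close> is possible, but \<open>b1\<close> with chameleon
      \<open>a1\<close> is not.\<close>
    show "good n (lighter {a1, b1} {a2, a3} ?L)"
      by (rule goodI[of a1 _ b1]) (use lt dist in \<open>auto simp: lighter_def\<close>)
    show "good n (lighter {a2, a3} {a1, b1} ?L)"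
      by (rule goodI[of a2 _ b1]) (use lt dist in \<open>auto simp: lighter_def\<close>)
  next
    let ?G = "{(f, c). f = a3 \<or> f \<in> {b2, b3} \<and> c \<notin> {a1, a2, a3, b1, b2, b3}}"
    show "good n (balanced {b2} {b3} ?G)"
      by (rule goodI[of a3 _ b1]) (use lt dist in \<open>auto simp: balanced_def\<close>)
    show "good n (lighter {b2} {b3} ?G)"
      by (rule goodI[of a3 _ b2]) (use lt dist in \<open>auto simp: lighter_def\<close>)
    show "good n (lighter {b3} {b2} ?G)"
      by (rule goodI[of a3 _ b3]) (use lt dist in \<open>auto simp: lighter_def\<close>)
  qed
  ultimately show ?thesis by blast
qed

text \<open>By monotonicity it suffices to treat two largest good situations: no diagonal pair at
  all, or \<open>(a, a)\<close> possible with \<open>(b, a)\<close> and \<open>(b, b)\<close>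
  excluded.\<close>

lemma good_step:
  assumes "good N Q"
  shows "\<exists>t. num_weighings t \<le> 2 \<and> admissible (3 * N) t \<and>
      solves t (triple_pairs Q) \<and> all_leaves (good (3 * N)) t (triple_pairs Q)"
proof -
  obtain a b where ab: "a < N" "b < N" "a \<noteq> b" and Q: "fst ` Q \<subseteq> {a, b}" "(b, b) \<notin> Q"
    and or: "(a, a) \<notin> Q \<or> (b, a) \<notin> Q"
    using assms unfolding good_def by blast
  define a1 a2 a3 b1 b2 b3 where d: "a1 = 3 * a" "a2 = 3 * a + 1" "a3 = 3 * a + 2"
    "b1 = 3 * b" "b2 = 3 * b + 1" "b3 = 3 * b + 2"
  have lt: "{a1, a2, a3, b1, b2, b3} \<subseteq> {..<3 * N}"
    using ab d by auto
  have dist: "distinct [a1, a2, a3, b1, b2, b3]"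
  proof -
    have "3 * a \<noteq> 3 * b + k" "3 * a + 1 \<noteq> 3 * b + k" "3 * a + 2 \<noteq> 3 * b + k" if "k < 3" for k
      using ab(3) that by arith+
    from this[of 0] this[of 1] this[of 2] show ?thesis unfolding d by simp
  qed
  have mem: "x \<in> {a1, a2, a3} \<longleftrightarrow> x div 3 = a" "x \<in> {b1, b2, b3} \<longleftrightarrow> x div 3 = b" for x
    unfolding d by (rule mem_triple)+
  have mem6: "x \<in> {a1, a2, a3, b1, b2, b3} \<longleftrightarrow> x div 3 = a \<or> x div 3 = b" for x
    unfolding mem[symmetric] by simp
  have fst: "f = a \<or> f = b" if "(f, c) \<in> Q" for f c using that Q(1) by force
  obtain R where R: "triple_pairs Q \<subseteq> R" "\<exists>t. num_weighings t \<le> 2 \<and> admissible (3 * N) t \<and>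
      solves t R \<and> all_leaves (good (3 * N)) t R"
  proof (cases "(a, a) \<in> Q")
    case False
    then have "f = a \<and> c \<noteq> a \<or> f = b \<and> c \<noteq> b" if "(f, c) \<in> Q" for f c
      using that Q(2) fst[OF that] by blast
    then have "triple_pairs Q \<subseteq> {(f, c). f div 3 = a \<and> c div 3 \<noteq> a \<or> f div 3 = b \<and> c div 3 \<noteq> b}"
      unfolding triple_pairs_def by blast
    then show ?thesis
      by (rule that) (rule strategy_two_irreflexive[OF dist lt, unfolded mem])
  next
    case True
    with or have "(b, a) \<notin> Q" by simp
    then have "f = a \<or> f = b \<and> \<not> (c = a \<or> c = b)" if "(f, c) \<in> Q" for f c
      using that Q(2) fst[OF that] by blast
    then have "triple_pairs Q \<subseteq> {(f, c). f div 3 = a \<or> f div 3 = b \<and> \<not> (c div 3 = a \<or> c div 3 = b)}"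
      unfolding triple_pairs_def by blast
    then show ?thesis
      by (rule that) (rule strategy_one_reflexive[OF dist lt, unfolded mem mem6])
  qed
  then obtain t where "num_weighings t \<le> 2" "admissible (3 * N) t" "solves t R"
    "all_leaves (good (3 * N)) t R" by blast
  moreover from this have "all_leaves (good (3 * N)) t (triple_pairs Q)"
    by (intro all_leaves_antimono[OF _ _ R(1)]) (auto intro: good_mono)
  ultimately show ?thesis using solves_mono[OF _ R(1)] by blast
qed

section \<open>One weighing: counting announcements\<close>

primrec solvable :: "nat \<Rightarrow> nat \<Rightarrow> (nat \<times> nat) set \<Rightarrow> bool" where
  "solvable n 0 Q \<longleftrightarrow> (\<exists>X. finite X \<and> card X \<le> 2 \<and> fst ` Q \<subseteq> X)"
| "solvable n (Suc k) Q \<longleftrightarrow> (\<exists>A B. A \<subseteq> {..<n} \<and> B \<subseteq> {..<n} \<and> A \<inter> B = {} \<and> card A = card B \<and>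
     solvable n k (balanced A B Q) \<and> solvable n k (lighter A B Q) \<and> solvable n k (lighter B A Q))"

lemma solvable_mono: "solvable n k R \<Longrightarrow> Q \<subseteq> R \<Longrightarrow> solvable n k Q"
proof (induction k arbitrary: Q R)
  case 0
  then have "fst ` Q \<subseteq> fst ` R" by (intro image_mono)
  with 0 show ?case unfolding solvable.simps(1) by (meson order_trans)
next
  case (Suc k)
  then show ?case by simp (metis balanced_mono lighter_mono)
qed

lemma solvable_Suc: "solvable n k Q \<Longrightarrow> solvable n (Suc k) Q"
proof -
  assume "solvable n k Q"
  moreover have "balanced {} {} Q \<subseteq> Q" "lighter {} {} Q \<subseteq> Q"
    by (auto simp: balanced_def lighter_def)
  ultimately have "solvable n k (balanced {} {} Q)" "solvable n k (lighter {} {} Q)"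
    by (auto intro: solvable_mono)
  then show ?thesis by (auto intro!: exI[of _ "{}"])
qed

text \<open>Lower bounds need only the existence of suitable weighings; shorter trees are padded
  with weighings of empty pans.\<close>

lemma solvable_if_solves:
  "num_weighings t \<le> k \<Longrightarrow> admissible n t \<Longrightarrow> solves t Q \<Longrightarrow> solvable n k Q"
proof (induction t arbitrary: k Q)
  case (Output X)
  then have "solvable n 0 Q" by (auto intro: finite_subset)
  then show ?case by (induction k) (auto intro: solvable_Suc simp del: solvable.simps)
next
  case (Weigh A B T\<^sub>0 T\<^sub>1 T\<^sub>2)
  from Weigh.prems(1) obtain m where "k = Suc m" by (cases k) auto
  with Weigh show ?case
    unfolding \<open>k = Suc m\<close> solvable.simps by (intro exI[of _ A] exI[of _ B]) auto
qed

text \<open>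
  One weighing leaves room for six announcements: every candidate takes one, and a candidate
  compatible with every chameleon takes two, namely one of them under balance. If all six are
  used up, no other candidate can afford a chameleon that changes its outcome.
\<close>

lemma one_weighing:
  assumes sol: "solvable n 1 P" and F: "F \<subseteq> fst ` P" and D: "D \<subseteq> F" "D \<times> {..<n} \<subseteq> P"
  shows one_weighing_card: "card D \<le> 2" "card F + card D \<le> 6"
    and one_weighing_tight: "card F + card D = 6 \<Longrightarrow> \<exists>A B. D \<subseteq> A \<union> B \<and> A \<inter> B = {} \<and>
      card (F \<inter> A) \<le> 2 \<and> card (F \<inter> B) \<le> 2 \<and> card (F - (A \<union> B)) \<le> 2 \<and>
      (\<forall>(f, c)\<in>P. f \<in> F - D \<longrightarrow> (c \<in> A \<longrightarrow> f \<in> A) \<and> (c \<in> B \<longrightarrow> f \<in> B))"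
proof -
  obtain A B where AB: "A \<subseteq> {..<n}" "B \<subseteq> {..<n}" "A \<inter> B = {}" "card A = card B"
    and sol0: "solvable n 0 (balanced A B P)" "solvable n 0 (lighter A B P)" "solvable n 0 (lighter B A P)"
    using sol unfolding One_nat_def solvable.simps(2) by blast
  obtain E0 where E0: "finite E0" "card E0 \<le> 2" "fst ` balanced A B P \<subseteq> E0"
    using sol0(1) unfolding solvable.simps(1) by blast
  obtain E1 where E1: "finite E1" "card E1 \<le> 2" "fst ` lighter A B P \<subseteq> E1"
    using sol0(2) unfolding solvable.simps(1) by blast
  obtain E2 where E2: "finite E2" "card E2 \<le> 2" "fst ` lighter B A P \<subseteq> E2"
    using sol0(3) unfolding solvable.simps(1) by blast
  note E = E0(1,2) E1(1,2) E2(1,2) and sub = E0(3) E1(3) E2(3)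
  have E0: "f \<in> E0"
    if "(f, c) \<in> P" "f \<notin> A \<and> f \<notin> B \<or> f \<in> A \<and> c \<in> B \<or> f \<in> B \<and> c \<in> A" for f c
    using that sub(1) unfolding balanced_def by force
  have E1: "f \<in> E1" if "(f, c) \<in> P" "f \<in> A \<or> f \<notin> B \<and> c \<in> A" for f c
    using that sub(2) unfolding lighter_def by force
  have E2: "f \<in> E2" if "(f, c) \<in> P" "f \<in> B \<or> f \<notin> A \<and> c \<in> B" for f c
    using that sub(3) unfolding lighter_def by force
  have F': "\<exists>c. (f, c) \<in> P" if "f \<in> F" for f using that F by force
  have FA: "F \<inter> A \<subseteq> E1" and FB: "F \<inter> B \<subseteq> E2" and FO: "F - (A \<union> B) \<subseteq> E0"
    using F' E0 E1 E2 by blast+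
  have fin: "finite A" "finite B" using AB(1,2) by (auto intro: finite_subset)
  have FE: "F \<subseteq> E0 \<union> (E1 \<union> E2)" using FA FB FO by blast
  then have finF: "finite F" using E by (meson finite_UnI finite_subset)
  have "card D \<le> 2 \<and> card F + card D \<le> 6 \<and> (card F + card D = 6 \<longrightarrow>
    D \<subseteq> A \<union> B \<and> (\<forall>(f, c)\<in>P. f \<in> F - D \<longrightarrow> (c \<in> A \<longrightarrow> f \<in> A) \<and> (c \<in> B \<longrightarrow> f \<in> B)))"
  \<comment> \<open>Empty pans always balance, so all of \<open>F\<close> has to fit into
    \<open>E0\<close>.\<close>
  proof (cases "A = {}")
    case True
    with AB(4) fin have "B = {}" by auto
    with True FO have "F \<subseteq> E0" by blast
    with E(1,2) have "card F \<le> 2" using card_mono[of E0 F] by linarith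
    moreover have "card D \<le> card F" using D(1) finF by (intro card_mono)
    ultimately show ?thesis by simp
  next
    case False
    then obtain x where x: "x \<in> A" by blast
    from False AB(4) fin obtain y where y: "y \<in> B" by fastforce
    have Dxy: "(f, x) \<in> P" "(f, y) \<in> P" if "f \<in> D" for f
      using that D(2) x y AB(1,2) by auto
    \<comment> \<open>With chameleons \<open>x\<close> and \<open>y\<close> from opposite pans, a
      coin of \<open>D\<close> can both balance and tilt.\<close>
    have DE: "D \<subseteq> E0 \<inter> (E1 \<union> E2)"
    proof
      fix f assume "f \<in> D"
      from Dxy[OF this] show "f \<in> E0 \<inter> (E1 \<union> E2)"
        using E0[of f x] E0[of f y] E1[of f x] E2[of f y] x y by blast
    qed
    have "D \<subseteq> E0" using DE by blast
    with E(1,2) have D2: "card D \<le> 2" using card_mono[of E0 D] by linarith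
    \<comment> \<open>Inclusion-exclusion bounds \<open>card F + card D\<close> by the total size of
      the three announcements. Equality makes \<open>E1\<close> and \<open>E2\<close> disjoint and
      leaves only \<open>D\<close> in \<open>E0 \<inter> (E1 \<union> E2)\<close>.\<close>
    have "card E0 + card (E1 \<union> E2) = card (E0 \<union> (E1 \<union> E2)) + card (E0 \<inter> (E1 \<union> E2))"
      "card E1 + card E2 = card (E1 \<union> E2) + card (E1 \<inter> E2)"
      by (intro card_Un_Int finite_UnI E)+
    moreover have "card F \<le> card (E0 \<union> (E1 \<union> E2))" "card D \<le> card (E0 \<inter> (E1 \<union> E2))"
      by (intro card_mono FE DE finite_UnI finite_Int disjI1 E)+
    ultimately have le: "card F + card D \<le> 6" and
      "card F + card D = 6 \<longrightarrow> card (E0 \<inter> (E1 \<union> E2)) = card D \<and> card (E1 \<inter> E2) = 0"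
      using E(2,4,6) by linarith+
    moreover have "D \<subseteq> A \<union> B \<and> (\<forall>(f, c)\<in>P. f \<in> F - D \<longrightarrow> (c \<in> A \<longrightarrow> f \<in> A) \<and> (c \<in> B \<longrightarrow> f \<in> B))"
      if "card (E0 \<inter> (E1 \<union> E2)) = card D" "card (E1 \<inter> E2) = 0"
    proof -
      have 0: "D = E0 \<inter> (E1 \<union> E2)"
        using that(1) E(1) DE by (intro card_subset_eq finite_Int disjI1) auto
      have 12: "E1 \<inter> E2 = {}" using that(2) E(3) by simp
      \<comment> \<open>Off the pans, \<open>f\<close> could tilt either way, with chameleon
        \<open>x\<close> or \<open>y\<close>, and would lie in both \<open>E1\<close> and
        \<open>E2\<close>.\<close>
      have "f \<in> A \<union> B" if "f \<in> D" for f
        using Dxy[OF that] E1[of f x] E2[of f y] x y 12 by blast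
      \<comment> \<open>With the chameleon on a pan that does not hold \<open>f\<close>, the coin
        \<open>f\<close> could both balance and tilt, and would belong to \<open>D\<close>.\<close>
      moreover have "(c \<in> A \<longrightarrow> f \<in> A) \<and> (c \<in> B \<longrightarrow> f \<in> B)" if "(f, c) \<in> P" "f \<in> F - D" for f c
        using that E0[of f c] E1[of f c] E2[of f c] 0 AB(3) by blast
      ultimately show ?thesis by blast
    qed
    ultimately show ?thesis using D2 by blast
  qed
  moreover have "card (F \<inter> A) \<le> 2" "card (F \<inter> B) \<le> 2" "card (F - (A \<union> B)) \<le> 2"
    using card_mono[OF E(3) FA] card_mono[OF E(5) FB] card_mono[OF E(1) FO] E by linarith+
  ultimately show "card D \<le> 2" "card F + card D \<le> 6" "card F + card D = 6 \<Longrightarrow>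
    \<exists>A B. D \<subseteq> A \<union> B \<and> A \<inter> B = {} \<and>
      card (F \<inter> A) \<le> 2 \<and> card (F \<inter> B) \<le> 2 \<and> card (F - (A \<union> B)) \<le> 2 \<and>
      (\<forall>(f, c)\<in>P. f \<in> F - D \<longrightarrow> (c \<in> A \<longrightarrow> f \<in> A) \<and> (c \<in> B \<longrightarrow> f \<in> B))"
    using AB(3) by blast+
qed

lemma card_three_le_two:
  assumes "card E \<le> 2" "finite E" "{x, y, z} \<subseteq> E" "distinct [x, y, z]"
  shows False
  using card_mono[OF assms(2,3)] assms(1,4) by simp

text \<open>No place (either pan or off the scale) holds three coins of \<open>F\<close>, whereas
  pairs in \<open>P\<close> tend to force coins into the same place. The next three lemmas exploit
  this conflict.\<close>

lemma one_weighing_not_together: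
  assumes "solvable n 1 P" "F \<subseteq> fst ` P" "D \<subseteq> F" "D \<times> {..<n} \<subseteq> P" "card F + card D = 6" "finite F"
    and "{x, y, z} \<subseteq> F" "distinct [x, y, z]"
  obtains A B where "D \<subseteq> A \<union> B" "A \<inter> B = {}"
    "\<And>f c. (f, c) \<in> P \<Longrightarrow> f \<in> F - D \<Longrightarrow> (c \<in> A \<longrightarrow> f \<in> A) \<and> (c \<in> B \<longrightarrow> f \<in> B)"
    "\<not> {x, y, z} \<subseteq> A" "\<not> {x, y, z} \<subseteq> B" "{x, y, z} \<inter> (A \<union> B) \<noteq> {}"
proof -
  obtain A B where AB: "D \<subseteq> A \<union> B" "A \<inter> B = {}"
    and le: "card (F \<inter> A) \<le> 2" "card (F \<inter> B) \<le> 2" "card (F - (A \<union> B)) \<le> 2"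
    and P: "\<forall>(f, c)\<in>P. f \<in> F - D \<longrightarrow> (c \<in> A \<longrightarrow> f \<in> A) \<and> (c \<in> B \<longrightarrow> f \<in> B)"
    using one_weighing_tight[OF assms(1-5)] by blast
  have "\<not> {x, y, z} \<subseteq> F \<inter> A" "\<not> {x, y, z} \<subseteq> F \<inter> B" "\<not> {x, y, z} \<subseteq> F - (A \<union> B)"
    using card_three_le_two[OF le(1) _ _ assms(8)] card_three_le_two[OF le(2) _ _ assms(8)]
      card_three_le_two[OF le(3) _ _ assms(8)] assms(6) by blast+
  with assms(7) have "\<not> {x, y, z} \<subseteq> A" "\<not> {x, y, z} \<subseteq> B" "{x, y, z} \<inter> (A \<union> B) \<noteq> {}"
    by blast+
  moreover have "(c \<in> A \<longrightarrow> f \<in> A) \<and> (c \<in> B \<longrightarrow> f \<in> B)" if "(f, c) \<in> P" "f \<in> F - D" for f c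
    using P that by blast
  ultimately show ?thesis using that[OF AB] by blast
qed

text \<open>Six candidates are tight already; the mutual links of \<open>z\<close> with
  \<open>x\<close> and \<open>y\<close> force all three into one place.\<close>

lemma not_solvable_six:
  assumes "solvable n 1 P" "F \<subseteq> fst ` P" "card F = 6" "distinct [x, y, z]" "{x, y, z} \<subseteq> F"
    and P: "(x, z) \<in> P" "(y, z) \<in> P" "(z, x) \<in> P" "(z, y) \<in> P"
  shows False
proof -
  have fin: "finite F" using assms(3) by (auto intro: card_ge_0_finite)
  show False
  proof (rule one_weighing_not_together[OF assms(1,2), of "{}" x y z])
    fix A B
    assume AB: "\<not> {x, y, z} \<subseteq> A" "\<not> {x, y, z} \<subseteq> B" "{x, y, z} \<inter> (A \<union> B) \<noteq> {}"
      and tight: "\<And>f c. (f, c) \<in> P \<Longrightarrow> f \<in> F - {} \<Longrightarrow> (c \<in> A \<longrightarrow> f \<in> A) \<and> (c \<in> B \<longrightarrow> f \<in> B)"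
    show False
      using AB tight[OF P(1)] tight[OF P(2)] tight[OF P(3)] tight[OF P(4)] assms(5) by blast
  qed (use assms(3-5) fin in simp_all)
qed

text \<open>The full row of \<open>z\<close> raises five candidates to the tight count; the links
  force \<open>u\<close>, \<open>v\<close> and \<open>x\<close> into one place.\<close>

lemma not_solvable_five_off:
  assumes "solvable n 1 P" "{u, v, x, y, z} \<subseteq> fst ` P" "distinct [u, v, x, y, z]"
    and "{z} \<times> {..<n} \<subseteq> P" and P: "{u, v} \<times> {x, y} \<subseteq> P" "{x, y} \<times> {u, v} \<subseteq> P"
  shows False
proof -
  let ?F = "{u, v, x, y, z}"
  have ne: "u \<noteq> z" "v \<noteq> z" "x \<noteq> z" using assms(3) by auto
  show False
  proof (rule one_weighing_not_together[OF assms(1,2), of "{z}" u v x])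
    fix A B
    assume AB: "\<not> {u, v, x} \<subseteq> A" "\<not> {u, v, x} \<subseteq> B" "{u, v, x} \<inter> (A \<union> B) \<noteq> {}"
      and tight: "\<And>f c. (f, c) \<in> P \<Longrightarrow> f \<in> ?F - {z} \<Longrightarrow> (c \<in> A \<longrightarrow> f \<in> A) \<and> (c \<in> B \<longrightarrow> f \<in> B)"
    show False
      using ne AB tight[of u x] tight[of v x] tight[of x u] tight[of x v] P by blast
  qed (use assms(3,4) in simp_all)
qed

text \<open>The count is tight again, so \<open>z\<close> is on a pan and draws \<open>x\<close> and
  \<open>y\<close> onto it; \<open>u\<close> and \<open>v\<close> serve the count.\<close>

lemma not_solvable_five_on:
  assumes "solvable n 1 P" "{u, v, x, y, z} \<subseteq> fst ` P" "distinct [u, v, x, y, z]"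
    and "{z} \<times> {..<n} \<subseteq> P" and P: "(x, z) \<in> P" "(y, z) \<in> P"
  shows False
proof -
  let ?F = "{u, v, x, y, z}"
  have ne: "x \<noteq> z" "y \<noteq> z" using assms(3) by auto
  show False
  proof (rule one_weighing_not_together[OF assms(1,2), of "{z}" x y z])
    fix A B
    assume AB: "\<not> {x, y, z} \<subseteq> A" "\<not> {x, y, z} \<subseteq> B" "{z} \<subseteq> A \<union> B"
      and tight: "\<And>f c. (f, c) \<in> P \<Longrightarrow> f \<in> ?F - {z} \<Longrightarrow> (c \<in> A \<longrightarrow> f \<in> A) \<and> (c \<in> B \<longrightarrow> f \<in> B)"
    show False
      using ne AB tight[OF P(1)] tight[OF P(2)] by blast
  qed (use assms(3,4) in simp_all)
qed

section \<open>Two weighings: an unresolvable pair of triples\<close>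

lemma balanced_commute: "balanced A B Q = balanced B A Q"
  by (auto simp: balanced_def)

text \<open>Counting after balance and after a tilt towards \<open>A\<close> forces
  \<open>card (T \<inter> B) = card (S \<inter> A)\<close> and
  \<open>card (T \<inter> A) = card (S - A)\<close>. The two possible splits of \<open>S\<close> are
  refuted after balance and after the tilt, respectively.\<close>

lemma not_solvable_two_one_sided:
  assumes P: "S \<times> {..<n} \<subseteq> P" "T \<times> S \<subseteq> P"
    and ST: "S \<subseteq> {..<n}" "T \<subseteq> {..<n}" "card S = 3" "card T = 3" "S \<inter> T = {}"
    and AB: "A \<inter> B = {}" "S \<inter> A \<noteq> {}" "S \<inter> B = {}"
    and sol: "solvable n 1 (balanced A B P)" "solvable n 1 (lighter A B P)"
  shows False
proof -
  have fin: "finite S" "finite T" using ST(3,4) by (auto intro: card_ge_0_finite)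
  have card_S: "card (S \<inter> A) + card (S - A) = 3"
    using card_Diff_subset_Int[of S A] card_mono[of S "S \<inter> A"] fin ST(3) by auto
  have SF: "(s, t) \<in> P" if "s \<in> S" "t \<in> S \<union> T" for s t using that P ST by auto
  obtain s where s: "s \<in> S" "s \<in> A" using AB(2) by auto
  have bal: "S \<union> (T - A) \<subseteq> fst ` balanced A B P" if TB: "T \<inter> B \<noteq> {}"
  proof -
    obtain t where t: "t \<in> T" "t \<in> B" using TB by auto
    \<comment> \<open>On \<open>A\<close>, the fake is cancelled by the chameleon \<open>t\<close>
      on \<open>B\<close>; off the pans it balances anyway.\<close>
    have "(f, t) \<in> balanced A B P" if "f \<in> S" for f
      using that t SF AB by (auto simp: balanced_def)
    moreover have "(f, s) \<in> balanced A B P" if "f \<in> T - A" for f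
      using that s P(2) by (auto simp: balanced_def)
    ultimately show ?thesis by force
  qed
  have lig: "S \<union> (T - B) \<subseteq> fst ` lighter A B P"
  proof -
    have "(f, s) \<in> lighter A B P" if "f \<in> S \<union> (T - B)" for f
      using that s SF P(2) AB by (auto simp: lighter_def)
    then show ?thesis by force
  qed
  have "card (S \<union> (T - B)) + card (S \<inter> A) \<le> 6"
    by (rule one_weighing_card(2)[OF sol(2) lig]) (use P in \<open>auto simp: lighter_def\<close>)
  moreover have "card (S \<union> (T - B)) = 3 + card (T - B)"
    using fin ST by (subst card_Un_disjoint) auto
  ultimately have 1: "card (T - B) + card (S \<inter> A) \<le> 3" by simp
  \<comment> \<open>If \<open>T\<close> missed \<open>B\<close>, all its coins would survive the
    tilt, against the bound; hence the count after balance is available too.\<close>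
  have "card (T - B) < card T" using 1 s fin ST(4) card_gt_0_iff[of "S \<inter> A"] by auto
  then have "T \<inter> B \<noteq> {}" by (metis Diff_triv less_irrefl)
  note bal = bal[OF this]
  have "card (S \<union> (T - A)) + card (S - A) \<le> 6"
    by (rule one_weighing_card(2)[OF sol(1) bal]) (use P AB in \<open>auto simp: balanced_def\<close>)
  moreover have "card (S \<union> (T - A)) = 3 + card (T - A)"
    using fin ST by (subst card_Un_disjoint) auto
  ultimately have 2: "card (T - A) + card (S - A) \<le> 3" by simp
  have "card (T \<inter> A) + card (T - A) = 3" "card (T \<inter> B) + card (T - B) = 3"
    using card_Diff_subset_Int[of T A] card_mono[of T "T \<inter> A"]
      card_Diff_subset_Int[of T B] card_mono[of T "T \<inter> B"] fin ST(4) by auto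
  moreover have "card (T \<inter> A) \<le> card (T - B)"
    using fin AB(1) by (intro card_mono) auto
  ultimately have cards: "card (T \<inter> B) = card (S \<inter> A)" "card (T \<inter> A) = card (S - A)"
    using 1 2 card_S by linarith+
  have "card (S \<inter> A) \<le> 2"
    by (rule one_weighing_card(1)[OF sol(2), of "S \<inter> A"])
      (use lig P in \<open>auto simp: lighter_def\<close>)
  then consider "card (S \<inter> A) = 2" "card (S - A) = 1" | "card (S \<inter> A) = 1" "card (S - A) = 2"
    using card_S card_gt_0_iff[of "S \<inter> A"] AB(2) fin by fastforce
  then show False
  proof cases
    case 1
    then obtain u v x y z where uv: "S \<inter> A = {u, v}" "u \<noteq> v" and xy: "T \<inter> B = {x, y}" "x \<noteq> y"
      and z: "S - A = {z}"
      using cards by (metis card_1_singletonE card_2_iff)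
    have mem: "u \<in> S" "v \<in> S" "z \<in> S" "x \<in> T" "y \<in> T" "u \<in> A" "v \<in> A" "x \<in> B" "y \<in> B"
      "z \<notin> A" "z \<notin> B"
      using uv xy z AB(3) by auto
    show False
    proof (rule not_solvable_five_off[OF sol(1), of u v x y z])
      show "distinct [u, v, x, y, z]" using mem uv xy ST(5) by auto
      show "{u, v, x, y, z} \<subseteq> fst ` balanced A B P" using bal mem AB(1) by auto
      show "{z} \<times> {..<n} \<subseteq> balanced A B P" using mem P by (auto simp: balanced_def)
      show "{u, v} \<times> {x, y} \<subseteq> balanced A B P" using mem SF by (auto simp: balanced_def)
      show "{x, y} \<times> {u, v} \<subseteq> balanced A B P" using mem P by (auto simp: balanced_def)
    qed
  next
    case 2
    then obtain u v x y z where uv: "T \<inter> A = {u, v}" "u \<noteq> v" and xy: "S - A = {x, y}" "x \<noteq> y"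
      and z: "S \<inter> A = {z}"
      using cards by (metis card_1_singletonE card_2_iff)
    have mem: "u \<in> T" "v \<in> T" "z \<in> S" "x \<in> S" "y \<in> S" "u \<in> A" "v \<in> A" "x \<notin> A" "y \<notin> A"
      "x \<notin> B" "y \<notin> B" "z \<in> A"
      using uv xy z AB(3) by auto
    show False
    proof (rule not_solvable_five_on[OF sol(2), of u v x y z])
      show "distinct [u, v, x, y, z]" using mem uv xy ST(5) by auto
      show "{u, v, x, y, z} \<subseteq> fst ` lighter A B P" using lig mem AB(1) by auto
      show "{z} \<times> {..<n} \<subseteq> lighter A B P" using mem P by (auto simp: lighter_def)
      show "(x, z) \<in> lighter A B P" "(y, z) \<in> lighter A B P"
        using mem SF by (auto simp: lighter_def)
    qed
  qed
qed

text \<open>If \<open>S\<close> is off the pans, balance keeps three full rows, one too many. If it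
  meets both pans, balance keeps six candidates and allows no full row, so \<open>S\<close> lies on
  the pans, two coins against one, and these three are linked.\<close>

lemma not_solvable_two:
  assumes P: "S \<times> {..<n} \<subseteq> P" "T \<times> S \<subseteq> P"
    and ST: "S \<subseteq> {..<n}" "T \<subseteq> {..<n}" "card S = 3" "card T = 3" "S \<inter> T = {}"
  shows "\<not> solvable n 2 P"
proof
  assume "solvable n 2 P"
  then obtain A B where AB: "A \<inter> B = {}" and sol: "solvable n 1 (balanced A B P)"
    "solvable n 1 (lighter A B P)" "solvable n 1 (lighter B A P)"
    unfolding numeral_2_eq_2 solvable.simps(2)[of _ "Suc 0"] One_nat_def by blast
  have fin: "finite S" "finite T" using ST(3,4) by (auto intro: card_ge_0_finite)
  consider "S \<inter> A = {}" "S \<inter> B = {}" | "S \<inter> A \<noteq> {}" "S \<inter> B = {}" | "S \<inter> B \<noteq> {}" "S \<inter> A = {}"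
    | "S \<inter> A \<noteq> {}" "S \<inter> B \<noteq> {}" by blast
  then show False
  proof cases
    case 1
    have "(f, f) \<in> balanced A B P" if "f \<in> S" for f
      using that 1 P ST by (auto simp: balanced_def)
    then have "S \<subseteq> fst ` balanced A B P" by force
    moreover have "S \<times> {..<n} \<subseteq> balanced A B P" using 1 P by (auto simp: balanced_def)
    ultimately have "card S \<le> 2" by (intro one_weighing_card(1)[OF sol(1), of S]) auto
    with ST show False by simp
  next
    case 2
    with not_solvable_two_one_sided[OF P ST AB 2] sol show False by blast
  next
    case 3
    have "B \<inter> A = {}" using AB by blast
    with not_solvable_two_one_sided[OF P ST _ 3] sol show False
      by (simp add: balanced_commute)
  next
    case 4
    then obtain s t where st: "s \<in> S" "s \<in> A" "t \<in> S" "t \<in> B" by blast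
    have F: "S \<union> T \<subseteq> fst ` balanced A B P"
    proof
      fix f assume f: "f \<in> S \<union> T"
      \<comment> \<open>If \<open>f\<close> is on a pan, one of \<open>s\<close> and
        \<open>t\<close> lies opposite and can cancel it.\<close>
      have "(f, s) \<in> P" "(f, t) \<in> P" using f st P ST by auto
      then have "(f, s) \<in> balanced A B P \<or> (f, t) \<in> balanced A B P"
        using st by (auto simp: balanced_def)
      then show "f \<in> fst ` balanced A B P" by force
    qed
    have card6: "card (S \<union> T) = 6" using fin ST by (subst card_Un_disjoint) auto
    have "card (S \<union> T) + card (S - A - B) \<le> 6"
      by (rule one_weighing_card(2)[OF sol(1) F]) (use P in \<open>auto simp: balanced_def\<close>)
    then have "S - A - B = {}" using fin card6 by simp
    then have "S = (S \<inter> A) \<union> (S \<inter> B)" by blast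
    then have "card (S \<inter> A) + card (S \<inter> B) = 3"
      using fin AB ST(3) by (metis card_Un_disjoint finite_Int inf_bot_right inf_left_commute inf_assoc)
    moreover have "card (S \<inter> A) > 0" "card (S \<inter> B) > 0" using 4 fin by (auto simp: card_gt_0_iff)
    ultimately have "card (S \<inter> A) = 2 \<or> card (S \<inter> B) = 2" by linarith
    then obtain x y z where xyz: "{x, y, z} \<subseteq> S" "x \<noteq> y"
      "x \<in> A \<and> y \<in> A \<and> z \<in> B \<or> x \<in> B \<and> y \<in> B \<and> z \<in> A"
    proof
      assume "card (S \<inter> A) = 2"
      then obtain x y where "S \<inter> A = {x, y}" "x \<noteq> y" by (metis card_2_iff)
      then show ?thesis using st that[of x y t] by blast
    next
      assume "card (S \<inter> B) = 2"
      then obtain x y where "S \<inter> B = {x, y}" "x \<noteq> y" by (metis card_2_iff)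
      then show ?thesis using st that[of x y s] by blast
    qed
    have sub: "{x, y, z} \<subseteq> {..<n}" using xyz ST by blast
    show False
    proof (rule not_solvable_six[OF sol(1) F card6, of x y z])
      show "distinct [x, y, z]" using xyz AB by auto
      show "{x, y, z} \<subseteq> S \<union> T" using xyz by auto
      show "(x, z) \<in> balanced A B P" "(y, z) \<in> balanced A B P"
        "(z, x) \<in> balanced A B P" "(z, y) \<in> balanced A B P"
        using xyz sub P by (auto simp: balanced_def)
    qed
  qed
qed

text \<open>Tripling \<open>(p, p)\<close> and \<open>(q, p)\<close> produces the unresolvable pair
  of triples. Excluding this in both orders leaves, with full rows, only good situations.\<close>

lemma good_if_solvable:
  assumes "N \<ge> 2" "full_rows N Q" "X \<subseteq> {..<N}" "card X \<le> 2" "fst ` Q \<subseteq> X"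
    and "solvable (3 * N) 2 (triple_pairs Q)"
  shows "good N Q"
proof -
  obtain a b where ab: "a < N" "b < N" "a \<noteq> b" "fst ` Q \<subseteq> {a, b}"
    using two_candidates[OF assms(1,3,4)] assms(5) by (metis subset_trans)
  have not: "(p, p) \<notin> Q \<or> (q, p) \<notin> Q" if "p < N" "q < N" "p \<noteq> q" for p q
  proof (rule ccontr)
    assume "\<not> ?thesis"
    then have pp: "(p, p) \<in> Q" "(q, p) \<in> Q" by auto
    let ?S = "triples {p}" and ?T = "triples {q}"
    have "?S \<times> {..<3 * N} \<subseteq> triple_pairs Q" "?T \<times> ?S \<subseteq> triple_pairs Q"
      using pp assms(2) by (auto simp: full_rows_def triple_pairs_def mem_triples)
    moreover have "?S \<subseteq> {..<3 * N}" "?T \<subseteq> {..<3 * N}" "card ?S = 3" "card ?T = 3" "?S \<inter> ?T = {}"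
      using that by (simp_all add: triples_subset card_triples triples_disjoint)
    ultimately show False using not_solvable_two assms(6) by blast
  qed
  have full: "(t, t) \<in> Q \<Longrightarrow> c < N \<Longrightarrow> (t, c) \<in> Q" for t c
    using assms(2) by (auto simp: full_rows_def)
  show ?thesis
  proof (cases "(b, b) \<in> Q")
    case True
    \<comment> \<open>The coins exchange roles: \<open>(a, a)\<close> would fill the row of
      \<open>a\<close> and bring in the excluded \<open>(a, b)\<close>.\<close>
    then have "(b, a) \<in> Q" "(a, b) \<notin> Q" using full not[of b a] ab by auto
    then have "(a, a) \<notin> Q" using full ab by blast
    with \<open>(a, b) \<notin> Q\<close> ab show ?thesis
      unfolding good_def by (intro exI[of _ b] exI[of _ a] conjI) auto
  next
    case False
    with not[of a b] ab show ?thesis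
      unfolding good_def by (intro exI[of _ a] exI[of _ b] conjI) auto
  qed
qed

section \<open>Assembling the scaled solution\<close>

lemma all_leaves_mono:
  "all_leaves P T Q \<Longrightarrow> (\<And>Q. P Q \<Longrightarrow> P' Q) \<Longrightarrow> all_leaves P' T Q"
  by (induction T arbitrary: Q) auto

theorem theorem6:
  fixes w N :: nat and S :: strategy
  assumes "N \<ge> 2"
    and "scalable_solution w N S"
  shows "\<exists>T. extends_by 2 (scaling S) T \<and> scalable_solution (w + 2) (3 * N) T"
proof -
  have N3: "3 * N \<ge> 2" "3 * (3 * N) \<ge> 2" using assms(1) by auto
  note iff = fc_solution_iff_solves[OF assms(1)] fc_solution_iff_solves[OF N3(1)]
    fc_solution_iff_solves[OF N3(2)]
  obtain T\<^sub>0 where S: "admissible N S" "num_weighings S \<le> w" "solves S (all_pairs N)"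
    and T\<^sub>0: "extends_by 2 (scaling S) T\<^sub>0" "admissible (3 * N) T\<^sub>0"
      "solves T\<^sub>0 (triple_pairs (all_pairs N))"
    using assms(2) unfolding scalable_solution_def iff triple_pairs_all_pairs by blast
  have "full_rows N (all_pairs N)" by (auto simp: full_rows_def all_pairs_def)
  from all_leaves_of_extension[OF T\<^sub>0(1,3,2) this S(1,3)]
  have "all_leaves (good N) S (all_pairs N)"
    by (rule all_leaves_mono)
      (elim conjE exE, rule good_if_solvable[OF assms(1)], (assumption | rule solvable_if_solves)+)
  from extension_of_all_leaves[OF good_step S(1) this]
  obtain T where T: "extends_by 2 (scaling S) T" "admissible (3 * N) T"
    "num_weighings T \<le> num_weighings S + 2" "solves T (all_pairs (3 * N))"
    "all_leaves (good (3 * N)) T (all_pairs (3 * N))"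
    unfolding triple_pairs_all_pairs by blast
  \<comment> \<open>The leaves of \<open>T\<close> are good again, so a second round applies;
    \<open>T'\<close> witnesses that \<open>T\<close> is scalable.\<close>
  from extension_of_all_leaves[OF good_step T(2,5)]
  obtain T' where T': "extends_by 2 (scaling T) T'" "admissible (3 * (3 * N)) T'"
    "num_weighings T' \<le> num_weighings T + 2" "solves T' (all_pairs (3 * (3 * N)))"
    unfolding triple_pairs_all_pairs by blast
  have "scalable_solution (w + 2) (3 * N) T"
    unfolding scalable_solution_def iff using T T' S(2) by (intro conjI exI[of _ T']) auto
  with T(1) show ?thesis by blast
qed

end
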